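(* Let $\tau>0$. Let $y(t)$, with $y(+\infty)=0$, slowly oscillate around $0$ and satisfy the equation $$y''(t)-Ay'(t)-By(t)-C(t)y(t-\tau)=0,\quad t\in\mathbb{R},$$ where $A,B>0$ and the continuous function $C(t)$ converges to a positive number $C$ as $t\to+\infty$. Suppose also that the set of zeros of $y'(t)$ does not contain a non-degenerate interval. Then $y(t)$ is not a super-exponentially decaying (i.e. small) solution.
   Context: Number of sign changes: let $\mathbb{K}=[-\tau,0]\cup\{1\}$. For $v\in C(\mathbb{K})\setminus\{0\}$ put $$\mathrm{sc}(v)=\sup\{k\ge1:\ \text{there are } t_0<\dots<t_k,\ t_j\in\mathbb{K},\ \text{such that } v(t_{i-1})v(t_i)<0 \text{ for } 1\le i\le k\},$$ and $\mathrm{sc}(v)=0$ if $v(s)\ge0$ for all $s\in\mathbb{K}$ or $v(s)\le0$ for all $s\in\mathbb{K}$. Slow oscillation: for a smooth function $\psi:[T_0,+\infty)\to\mathbb{R}$ and a real number $\kappa$, define $\overline{\psi}_t\in C(\mathbb{K})$ by $(\overline{\psi}_t)(s)=\psi(t+s)-\kappa$ for $s\in[-\tau,0]$ and $(\overline{\psi}_t)(1)=\psi'(t)$. The function $\psi$ is slowly oscillating around $\kappa$ on a connected interval $\mathfrak{J}\subset[T_0+\tau,+\infty)$ if (d1) $\psi$ oscillates around $\kappa$, and (d2) for each $t\in\mathfrak{J}$ either $\mathrm{sc}(\overline{\psi}_t)=1$ or $\mathrm{sc}(\overline{\psi}_t)=2$. In the claim, "$y$ slowly oscillates around $0$" means that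 this holds with $\kappa=0$ on some neighbourhood $\mathfrak{J}=[T,+\infty)$ of $+\infty$, where $y$ oscillates around $0$ in the sense that it takes both positive and negative values for arbitrarily large $t$. A solution $y$ with $y(+\infty)=0$ is super-exponentially decaying (a small solution) if it converges to $0$ at $+\infty$ faster than any exponential, i.e. $\lim_{t\to+\infty}e^{kt}y(t)=0$ for every $k>0$. *)

theory Defs
  imports "HOL-Analysis.Analysis" "HOL-Library.Extended_Nat"
begin

text \<open>
  Elements of $C(K)$ are represented by total functions on the reals of which only the values
  on \<open>KK \<tau>\<close> are used. The delay \<open>\<tau>\<close> is assumed to be positive throughout, so that the point 1
  is isolated in \<open>KK \<tau>\<close> and is its largest element.
\<close>

definition KK :: "real \<Rightarrow> real set" where
  "KK \<tau> = {-\<tau>..0} \<union> {1}"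

text \<open>
  The supremum may be infinite, hence \<open>enat\<close>. The number of sign changes is meant for functions
  that do not vanish identically on \<open>KK \<tau>\<close>; for the zero function the value below is 0.
\<close>

definition sc :: "real \<Rightarrow> (real \<Rightarrow> real) \<Rightarrow> enat" where
  "sc \<tau> v =
    (if (\<forall>s\<in>KK \<tau>. v s \<ge> 0) \<or> (\<forall>s\<in>KK \<tau>. v s \<le> 0) then 0
     else Sup (enat ` {k. k \<ge> 1 \<and>
            (\<exists>t :: nat \<Rightarrow> real.
               (\<forall>j\<in>{0..k}. t j \<in> KK \<tau>) \<and>
               (\<forall>i\<in>{1..k}. t (i - 1) < t i) \<and>
               (\<forall>i\<in>{1..k}. v (t (i - 1)) * v (t i) < 0))}))"

definition seg :: "(real \<Rightarrow> real) \<Rightarrow> real \<Rightarrow> real \<Rightarrow> real \<Rightarrow> real" where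
  "seg \<psi> \<kappa> t = (\<lambda>s. if s = 1 then deriv \<psi> t else \<psi> (t + s) - \<kappa>)"

definition oscillates_around :: "(real \<Rightarrow> real) \<Rightarrow> real \<Rightarrow> bool" where
  "oscillates_around \<psi> \<kappa> \<longleftrightarrow>
    (\<forall>T. (\<exists>t\<ge>T. \<psi> t > \<kappa>) \<and> (\<exists>t\<ge>T. \<psi> t < \<kappa>))"

text \<open>
  Here \<open>\<psi>\<close> is a differentiable function on \<open>{T0..}\<close>. As \<open>J \<subseteq> {T0 + \<tau>..}\<close> and \<open>\<tau> > 0\<close>, neither
  its values to the left of \<open>T0\<close> nor its derivative at \<open>T0\<close> matter for the segments.
\<close>

definition slowly_oscillating_on ::
  "real \<Rightarrow> real \<Rightarrow> (real \<Rightarrow> real) \<Rightarrow> real \<Rightarrow> real set \<Rightarrow> bool" where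
  "slowly_oscillating_on \<tau> T0 \<psi> \<kappa> J \<longleftrightarrow>
    is_interval J \<and> J \<subseteq> {T0 + \<tau>..} \<and>
    oscillates_around \<psi> \<kappa> \<and>
    (\<forall>t\<in>J. sc \<tau> (seg \<psi> \<kappa> t) = 1 \<or> sc \<tau> (seg \<psi> \<kappa> t) = 2)"

definition slowly_oscillates :: "real \<Rightarrow> (real \<Rightarrow> real) \<Rightarrow> real \<Rightarrow> bool" where
  "slowly_oscillates \<tau> \<psi> \<kappa> \<longleftrightarrow> (\<exists>T0 T. slowly_oscillating_on \<tau> T0 \<psi> \<kappa> {T..})"

definition delay_solution ::
  "real \<Rightarrow> real \<Rightarrow> real \<Rightarrow> (real \<Rightarrow> real) \<Rightarrow> (real \<Rightarrow> real) \<Rightarrow> bool" where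
  "delay_solution \<tau> A B C y \<longleftrightarrow>
    (\<forall>t. y differentiable (at t)) \<and>
    (\<forall>t. deriv y differentiable (at t)) \<and>
    (\<forall>t. deriv (deriv y) t - A * deriv y t - B * y t - C t * y (t - \<tau>) = 0)"

definition super_exponentially_decaying :: "(real \<Rightarrow> real) \<Rightarrow> bool" where
  "super_exponentially_decaying y \<longleftrightarrow>
    (\<forall>k>0. ((\<lambda>t. exp (k * t) * y t) \<longlongrightarrow> 0) at_top)"

end

theory Submission
  imports Defs
begin

text \<open>
  Only two features of slow oscillation matter: \<open>y\<close> changes sign infinitely often, but never more
  than twice in a window of length \<open>\<tau>\<close>. At the maximum \<open>x\<close> of a positive hump of \<open>y\<close>
  the equation forces \<open>y (x - \<tau>) < 0\<close>, so the sign pattern of the delayed term between \<open>x\<close> and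
  the extremum \<open>x1\<close> of the next hump is known. This bounds the slope of \<open>y\<close> from below on
  \<open>{x..x1}\<close> by a multiple of \<open>y x\<close>; in particular \<open>x1 - x\<close> is bounded away from 0.
  If \<open>y\<close> were small, then for each \<open>k\<close> one could choose the hump such that all later humps have height
  at most \<open>2 * exp (- k * (x1 - x)) * y x\<close>. But a lower bound for \<open>y\<close> on a short interval
  forces, through the delayed term, a proportional lower bound a time \<open>\<tau>\<close> later, unless a
  later hump is comparably high; propagating this past \<open>x1\<close> is impossible, since there \<open>y\<close> is negative.
\<close>

section \<open>Humps\<close>

text \<open>Zeros inside \<open>{p..q}\<close> are allowed. The last two clauses make
  \<open>p\<close> and \<open>q\<close> genuine ends: negative values of \<open>f\<close> accumulate
  there from outside.\<close>

definition hump :: "(real \<Rightarrow> real) \<Rightarrow> real \<Rightarrow> real \<Rightarrow> real \<Rightarrow> bool" where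
  "hump f p x q \<longleftrightarrow> p < x \<and> x < q \<and> 0 < f x \<and> (\<forall>s\<in>{p..q}. 0 \<le> f s \<and> f s \<le> f x) \<and>
     (\<forall>e>0. \<exists>s. p - e < s \<and> s < p \<and> f s < 0) \<and> (\<forall>e>0. \<exists>s. q < s \<and> s < q + e \<and> f s < 0)"

text \<open>\<open>p\<close> is the supremum of the points of \<open>{u..t}\<close> where
  \<open>f\<close> is negative. A nonzero \<open>f p\<close> would keep its sign on one side of
  \<open>p\<close>: a negative one to the right, a positive one to the left, both against the choice
  of \<open>p\<close>.\<close>

lemma last_sign_change:
  fixes f :: "real \<Rightarrow> real"
  assumes cont: "continuous_on UNIV f" and "u < t" "f u < 0" "f t > 0"
  obtains p where "u \<le> p" "p < t" "\<forall>s\<in>{p..t}. 0 \<le> f s"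
    "\<forall>e>0. \<exists>s. p - e < s \<and> s < p \<and> f s < 0" "f p = 0"
proof -
  define S where "S = {s. u \<le> s \<and> s \<le> t \<and> f s < 0}"
  define p where "p = Sup S"
  have S: "u \<in> S" "bdd_above S" using assms by (auto simp: S_def intro!: bdd_aboveI[of _ t])
  have up: "u \<le> p" using cSup_upper[OF S] by (simp add: p_def)
  have pt: "p \<le> t" unfolding p_def using S by (intro cSup_least) (auto simp: S_def)
  have right: "0 \<le> f s" if "p < s" "s \<le> t" for s
  proof (rule ccontr)
    assume "\<not> 0 \<le> f s"
    then have "s \<in> S" using that up by (auto simp: S_def)
    then show False using cSup_upper[OF _ S(2)] that by (fastforce simp: p_def)
  qed
  have tend: "f \<midarrow>p\<rightarrow> f p" using cont continuous_on_eq_continuous_at[of UNIV f] by (auto simp: isCont_def)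
  have fp: "0 \<le> f p"
  proof (rule ccontr)
    assume "\<not> 0 \<le> f p"
    then have neg: "f p < 0" by simp
    then have "p < t" using pt assms(4) by (cases "p = t") auto
    have "eventually (\<lambda>s. f s < 0) (at_right p)"
      using order_tendstoD(2)[OF tend neg] by (simp add: eventually_at_split)
    then obtain b where "b > p" "\<forall>s. p < s \<and> s < b \<longrightarrow> f s < 0"
      by (auto simp: eventually_at_right_field)
    moreover obtain s where "p < s" "s < min b t"
      using \<open>b > p\<close> \<open>p < t\<close> dense[of p "min b t"] by auto
    ultimately show False using right[of s] by fastforce
  qed
  have left: "\<exists>s. p - e < s \<and> s < p \<and> f s < 0" if "e > 0" for e
  proof -
    have "p - e < Sup S" using that by (simp add: p_def)
    then obtain s where s: "s \<in> S" "p - e < s" using less_cSupE S by (metis empty_iff)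
    then have "s \<le> p" using cSup_upper[OF _ S(2)] by (simp add: p_def)
    moreover have "s \<noteq> p" using s fp by (auto simp: S_def)
    ultimately show ?thesis using s by (auto simp: S_def)
  qed
  have "f p = 0"
  proof (rule ccontr)
    assume "f p \<noteq> 0"
    then have "f p > 0" using fp by simp
    then have "eventually (\<lambda>s. f s > 0) (at_left p)"
      using order_tendstoD(1)[OF tend] by (simp add: eventually_at_split)
    then obtain b where "b < p" "\<forall>s. b < s \<and> s < p \<longrightarrow> f s > 0"
      by (auto simp: eventually_at_left_field)
    then show False using left[of "p - b"] by fastforce
  qed
  then show ?thesis using that[of p] up pt fp right left assms(4)
    by (metis atLeastAtMost_iff order_le_less order_less_irrefl)
qed

lemma first_sign_change:
  fixes f :: "real \<Rightarrow> real"
  assumes cont: "continuous_on UNIV f" and "t < u" "f u < 0" "f t > 0"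
  obtains q where "t < q" "q \<le> u" "\<forall>s\<in>{t..q}. 0 \<le> f s"
    "\<forall>e>0. \<exists>s. q < s \<and> s < q + e \<and> f s < 0" "f q = 0"
proof -
  have "continuous_on UNIV (\<lambda>s. f (- s))"
    by (intro continuous_on_compose2[OF cont] continuous_intros) auto
  then obtain p where p: "- u \<le> p" "p < - t" "\<forall>s\<in>{p..- t}. 0 \<le> f (- s)"
    "\<forall>e>0. \<exists>s. p - e < s \<and> s < p \<and> f (- s) < 0" "f (- p) = 0"
    using last_sign_change[of "\<lambda>s. f (- s)" "- u" "- t"] assms by auto
  have "0 \<le> f s" if "t \<le> s" "s \<le> - p" for s
    using p(3)[rule_format, of "- s"] that by auto
  moreover have "\<exists>s. - p < s \<and> s < - p + e \<and> f s < 0" if e: "e > 0" for e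
  proof -
    obtain s where "p - e < s" "s < p" "f (- s) < 0" using p(4) e by blast
    then show ?thesis by (intro exI[of _ "- s"]) auto
  qed
  ultimately show ?thesis using that[of "- p"] p by auto
qed

text \<open>\<open>x\<close> is a maximum over the interval between the sign changes nearest to
  \<open>t\<close>; it is interior because \<open>f\<close> vanishes at both ends while
  \<open>f t > 0\<close>.\<close>

lemma hump_exists:
  fixes f :: "real \<Rightarrow> real"
  assumes cont: "continuous_on UNIV f" and "u < t" "f u < 0" "f t > 0" "t < v" "f v < 0"
  obtains p x q where "hump f p x q" "u \<le> p" "p < t" "t < q"
proof -
  obtain p where p: "u \<le> p" "p < t" "\<forall>s\<in>{p..t}. 0 \<le> f s"
    "\<forall>e>0. \<exists>s. p - e < s \<and> s < p \<and> f s < 0" "f p = 0"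
    using last_sign_change[OF cont] assms by blast
  obtain q where q: "t < q" "q \<le> v" "\<forall>s\<in>{t..q}. 0 \<le> f s"
    "\<forall>e>0. \<exists>s. q < s \<and> s < q + e \<and> f s < 0" "f q = 0"
    using first_sign_change[OF cont] assms by blast
  obtain x where x: "x \<in> {p..q}" "\<forall>s\<in>{p..q}. f s \<le> f x"
    using continuous_attains_sup[of "{p..q}" f] p q continuous_on_subset[OF cont] by force
  have "f t \<le> f x" using x p q by auto
  then have fx: "f x > 0" using assms by simp
  then have "x \<noteq> p" "x \<noteq> q" using p q by auto
  then have "hump f p x q" unfolding hump_def
  proof (intro conjI)
    show "p < x" "x < q" using x(1) \<open>x \<noteq> p\<close> \<open>x \<noteq> q\<close> by auto
    show "\<forall>s\<in>{p..q}. 0 \<le> f s \<and> f s \<le> f x"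
      using x(2) p(3) q(3) by (metis atLeastAtMost_iff linorder_le_cases)
  qed (use fx p(4) q(4) in blast)+
  then show ?thesis using that p q by blast
qed

lemma deriv_lower_bound:
  fixes f f' :: "real \<Rightarrow> real"
  assumes "a \<le> b" and "\<And>s. a \<le> s \<Longrightarrow> s \<le> b \<Longrightarrow> (f has_real_derivative f' s) (at s)"
    and "\<And>s. a \<le> s \<Longrightarrow> s \<le> b \<Longrightarrow> \<beta> \<le> f' s"
  shows "\<beta> * (b - a) \<le> f b - f a"
proof -
  have "f a - \<beta> * a \<le> f b - \<beta> * b"
  proof (rule DERIV_nonneg_imp_nondecreasing[OF assms(1)])
    fix s assume "a \<le> s" "s \<le> b"
    then show "\<exists>y. ((\<lambda>s. f s - \<beta> * s) has_real_derivative y) (at s) \<and> 0 \<le> y"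
      by (intro exI[of _ "f' s - \<beta>"]) (auto intro!: derivative_eq_intros assms(2) simp: assms(3))
  qed
  then show ?thesis by (simp add: algebra_simps)
qed

section \<open>Propagation of lower bounds\<close>

text \<open>The assumptions are invariant under passing from \<open>y\<close> to \<open>- y\<close>,
  so every fact about positive humps also holds for negative ones. \<open>two_changes\<close>
  forbids four alternating values in a window of length \<open>\<tau>\<close>.\<close>

locale delay_eq =
  fixes \<tau> A B c c' T :: real and C y y' y'' :: "real \<Rightarrow> real"
  assumes \<tau>: "\<tau> > 0" and A: "A > 0" and B: "B > 0" and c: "c > 0"
    and Dy: "\<And>t. (y has_real_derivative y' t) (at t)"
    and Dy': "\<And>t. (y' has_real_derivative y'' t) (at t)"
    and eq: "\<And>t. y'' t = A * y' t + (B * y t + C t * y (t - \<tau>))"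
    and C: "\<And>t. t \<ge> T \<Longrightarrow> c \<le> C t" "\<And>t. t \<ge> T \<Longrightarrow> C t \<le> c'"
    and two_changes: "\<And>t s1 s2 s3 s4. \<lbrakk>t \<ge> T; t - \<tau> \<le> s1; s1 < s2; s2 < s3; s3 < s4; s4 \<le> t;
        y s1 * y s2 < 0; y s2 * y s3 < 0; y s3 * y s4 < 0\<rbrakk> \<Longrightarrow> False"
    and pos: "\<And>t. \<exists>s\<ge>t. y s > 0" and neg: "\<And>t. \<exists>s\<ge>t. y s < 0"
begin

lemma minus: "delay_eq \<tau> A B c c' T C (\<lambda>t. - y t) (\<lambda>t. - y' t) (\<lambda>t. - y'' t)"
proof
  show "\<exists>s\<ge>t. - y s > 0" "\<exists>s\<ge>t. - y s < 0" for t using neg[of t] pos[of t] by auto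
  show "False" if "t \<ge> T" "t - \<tau> \<le> s1" "s1 < s2" "s2 < s3" "s3 < s4" "s4 \<le> t"
        "- y s1 * - y s2 < 0" "- y s2 * - y s3 < 0" "- y s3 * - y s4 < 0" for t s1 s2 s3 s4
    using two_changes[OF that(1-6)] that(7-9) by simp
  show "((\<lambda>t. - y t) has_real_derivative - y' t) (at t)" for t by (rule DERIV_minus[OF Dy])
  show "((\<lambda>t. - y' t) has_real_derivative - y'' t) (at t)" for t by (rule DERIV_minus[OF Dy'])
qed (use \<tau> A B c C eq in \<open>auto simp: algebra_simps\<close>)

section \<open>Sign pattern around a hump\<close>

lemma cont: "continuous_on UNIV y"
  using Dy by (meson DERIV_isCont continuous_at_imp_continuous_on)

lemma c': "c' > 0" using c C[of T] by linarith

lemma hump_extremum: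
  assumes "hump y p x q"
  shows "y' x = 0" "y'' x \<le> 0"
proof -
  have h: "p < x" "x < q" "\<And>s. p \<le> s \<Longrightarrow> s \<le> q \<Longrightarrow> y s \<le> y x" using assms by (auto simp: hump_def)
  show y': "y' x = 0"
    by (rule DERIV_local_max[OF Dy, where d = "min (x - p) (q - x)"]) (use h in auto)
  show "y'' x \<le> 0"
  proof (rule ccontr)
    assume "\<not> y'' x \<le> 0"
    \<comment> \<open>If \<open>y'' x > 0\<close>, then \<open>y'\<close> is positive just to the
      right of \<open>x\<close>, so \<open>y\<close> would exceed its maximum over the hump
      there.\<close>
    then obtain d where d: "d > 0" "\<And>h. 0 < h \<Longrightarrow> h < d \<Longrightarrow> y' x < y' (x + h)"
      using DERIV_pos_inc_right[OF Dy', of x] by auto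
    define e where "e = min (d / 2) (q - x)"
    have e: "0 < e" "e < d" "x + e \<le> q" using d h by (auto simp: e_def)
    obtain z where "x < z" "z < x + e" "y (x + e) - y x = (x + e - x) * y' z"
      using MVT2[of x "x + e" y y'] Dy e by auto
    moreover have "y' z > 0" using d(2)[of "z - x"] y' calculation e by auto
    ultimately have "y (x + e) - y x > 0" using e(1) by simp
    then show False using h(3)[of "x + e"] e h by linarith
  qed
qed

text \<open>At the maximum the equation reduces to
  \<open>B * y x + C x * y (x - \<tau>) \<le> 0\<close>, which forces a negative delayed value. A
  positive value between \<open>x - \<tau>\<close> and \<open>p\<close> would then produce the signs
  -, +, -, + within one window.\<close>

lemma hump_delay:
  assumes "hump y p x q" "x \<ge> T"
  shows "x - \<tau> < p" "y (x - \<tau>) < 0" "\<And>s. x - \<tau> \<le> s \<Longrightarrow> s \<le> p \<Longrightarrow> y s \<le> 0"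
proof -
  have h: "p < x" "x < q" "y x > 0" "\<And>s. p \<le> s \<Longrightarrow> s \<le> q \<Longrightarrow> 0 \<le> y s"
    "\<And>e. e > 0 \<Longrightarrow> \<exists>s. p - e < s \<and> s < p \<and> y s < 0" using assms by (auto simp: hump_def)
  have "B * y x + C x * y (x - \<tau>) \<le> 0" using hump_extremum[OF assms(1)] eq[of x] by simp
  moreover have "B * y x > 0" using B h by simp
  ultimately have "C x * y (x - \<tau>) < 0" by linarith
  then show yn: "y (x - \<tau>) < 0" using C(1)[OF assms(2)] c by (simp add: mult_less_0_iff)
  show xp: "x - \<tau> < p" using h(4)[of "x - \<tau>"] yn h(2) \<tau> by force
  fix s assume s: "x - \<tau> \<le> s" "s \<le> p"
  show "y s \<le> 0"
  proof (rule ccontr)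
    assume "\<not> y s \<le> 0"
    then have ys: "y s > 0" by simp
    show False
    proof (cases "s = p")
      case True
      have "y \<midarrow>p\<rightarrow> y p" using Dy DERIV_isCont isCont_def by blast
      then have "eventually (\<lambda>s. y s > 0) (at_left p)"
        using order_tendstoD(1) ys True by (fastforce simp: eventually_at_split)
      then obtain b where "b < p" "\<forall>s. b < s \<and> s < p \<longrightarrow> y s > 0"
        by (auto simp: eventually_at_left_field)
      then show False using h(5)[of "p - b"] by fastforce
    next
      case False
      then obtain z where z: "s < z" "z < p" "y z < 0" using h(5)[of "p - s"] s by auto
      have "x - \<tau> < s" using s yn ys by (cases "s = x - \<tau>") auto
      then show False using two_changes[OF assms(2), of "x - \<tau>" s z x] z yn ys h \<tau>
        by (auto simp: mult_less_0_iff)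
    qed
  qed
qed

lemma hump_after:
  assumes "y u < 0" "u < t" "y t > 0"
  obtains p x q where "hump y p x q" "u \<le> p" "p < t" "t < q"
proof -
  obtain v where "v \<ge> t" "y v < 0" using neg by blast
  then have "t < v" using assms by (cases "t = v") auto
  then show ?thesis using hump_exists[OF cont, of u t v] assms \<open>y v < 0\<close> that by blast
qed

text \<open>Both signs cannot accumulate at \<open>q\<close> from the right, since this would give
  four alternating values in a window. So \<open>y\<close> is nonpositive just after
  \<open>q\<close>, with negative values, and the negative hump around such a value reaches back to
  \<open>q\<close>.\<close>

lemma next_hump:
  assumes "hump y p x q" "x \<ge> T"
  obtains p1 x1 r where "hump (\<lambda>s. - y s) p1 x1 r" "x \<le> p1" "p1 \<le> q" "q < x1"
proof -
  have h: "p < x" "x < q" "y x > 0" "\<And>s. p \<le> s \<Longrightarrow> s \<le> q \<Longrightarrow> 0 \<le> y s"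
    "\<And>e. e > 0 \<Longrightarrow> \<exists>s. q < s \<and> s < q + e \<and> y s < 0" using assms by (auto simp: hump_def)
  have "\<exists>e>0. \<forall>s. q < s \<and> s < q + e \<longrightarrow> y s \<le> 0"
  proof (rule ccontr)
    assume "\<not> ?thesis"
    then have P: "\<exists>s. q < s \<and> s < z \<and> y s > 0" if "z > q" for z
      using that by (metis add_diff_cancel_left' diff_add_cancel diff_gt_0_iff_gt add.commute not_le)
    have N: "\<exists>s. q < s \<and> s < z \<and> y s < 0" if "z > q" for z
      using h(5)[of "z - q"] that by auto
    obtain s4 where s4: "q < s4" "s4 < q + \<tau>" "y s4 < 0" using N[of "q + \<tau>"] \<tau> by auto
    obtain s3 where s3: "q < s3" "s3 < s4" "y s3 > 0" using P[of s4] s4 by auto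
    obtain s2 where s2: "q < s2" "s2 < s3" "y s2 < 0" using N[of s3] s3 by auto
    obtain s1 where s1: "q < s1" "s1 < s2" "y s1 > 0" using P[of s2] s2 by auto
    show False using two_changes[of "q + \<tau>" s1 s2 s3 s4] s1 s2 s3 s4 assms h \<tau>
      by (auto simp: mult_less_0_iff)
  qed
  then obtain e where e: "e > 0" "\<And>s. q < s \<Longrightarrow> s < q + e \<Longrightarrow> y s \<le> 0" by blast
  obtain t where t: "q < t" "t < q + e" "y t < 0" using h(5) e by blast
  interpret m: delay_eq \<tau> A B c c' T C "\<lambda>t. - y t" "\<lambda>t. - y' t" "\<lambda>t. - y'' t" by (rule minus)
  obtain p1 x1 r where h1: "hump (\<lambda>s. - y s) p1 x1 r" "x \<le> p1" "p1 < t" "t < r"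
    using m.hump_after[of x t] t h by auto
  have "p1 \<le> q"
  proof (rule ccontr)
    assume "\<not> p1 \<le> q"
    then obtain s where "q < s" "s < p1" "y s > 0"
      using h1(1) unfolding hump_def by (metis diff_diff_eq2 add_diff_cancel_left' diff_gt_0_iff_gt neg_less_0_iff_less not_le)
    then show False using e(2)[of s] t h1 by auto
  qed
  moreover have "q < x1"
  proof (rule ccontr)
    assume "\<not> q < x1"
    moreover have "p1 < x1" "- y x1 > 0" using h1 by (auto simp: hump_def)
    ultimately show False using h(4)[of x1] h1(2) h(1) by linarith
  qed
  ultimately show ?thesis using that h1 by blast
qed

section \<open>Slope bounds by an integrating factor\<close>

lemma weighted_deriv:
  "((\<lambda>s. exp (- (A * s)) * (y' s - k)) has_real_derivative
     exp (- (A * s)) * (B * y s + C s * y (s - \<tau>) + A * k)) (at s)"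
  by (auto intro!: derivative_eq_intros Dy' simp: eq algebra_simps)

text \<open>By \<open>weighted_deriv\<close> with \<open>- k\<close>, the function
  \<open>exp (- (A * s)) * (y' s + k)\<close> is nonincreasing on \<open>{a..b}\<close>; it is
  nonnegative at \<open>b\<close>, hence at \<open>a\<close>.\<close>

lemma slope_ge:
  assumes "a \<le> b" "y' b = 0" "k \<ge> 0"
    and "\<And>s. a \<le> s \<Longrightarrow> s \<le> b \<Longrightarrow> B * y s + C s * y (s - \<tau>) \<le> A * k"
  shows "- k \<le> y' a"
proof -
  have "0 * (b - a) \<le> - (exp (- (A * b)) * (y' b - (- k))) - - (exp (- (A * a)) * (y' a - (- k)))"
    by (rule deriv_lower_bound[OF assms(1) DERIV_minus[OF weighted_deriv]])
       (use assms(4) in \<open>auto simp: mult_le_0_iff\<close>)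
  moreover have "exp (- (A * b)) * (y' b - (- k)) \<ge> 0" using assms by simp
  ultimately have "0 \<le> exp (- (A * a)) * (y' a - (- k))" by linarith
  then show ?thesis by (simp add: zero_le_mult_iff)
qed

text \<open>Here \<open>x1\<close> is the extremum of the hump following the one of \<open>x0\<close>. If \<open>x1\<close> came too
  early, the delayed term would push \<open>y\<close> above \<open>\<epsilon>\<close> after \<open>x1\<close>; otherwise it is integrated
  backwards from \<open>x1\<close>.\<close>

lemma propagate:
  fixes h \<eta> \<epsilon> \<kappa> w p x0 x1 q :: real
  assumes T: "x0 \<ge> T" and w: "x0 \<le> w" "w + 2 * h \<le> q" and h: "h > 0" and \<eta>: "\<eta> > 0" and \<epsilon>: "\<epsilon> \<ge> 0"
    and q: "q < x1" "x1 \<le> q + \<tau>"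
    and p: "p \<le> x0" "p + \<tau> \<le> x1"
    and nn: "\<And>s. p \<le> s \<Longrightarrow> s \<le> q \<Longrightarrow> 0 \<le> y s"
    and low: "\<And>s. x0 \<le> s \<Longrightarrow> s \<le> x1 \<Longrightarrow> - \<epsilon> \<le> y s"
    and late: "\<And>t. t \<ge> x1 \<Longrightarrow> \<bar>y t\<bar> \<le> \<epsilon>"
    and x1: "y' x1 = 0"
    and win: "\<And>s. w \<le> s \<Longrightarrow> s \<le> w + 2 * h \<Longrightarrow> \<eta> \<le> y s"
    and \<kappa>: "0 < \<kappa>" "\<kappa> \<le> c * exp (- (A * h)) * h^2 / 4"
    and small: "\<epsilon> * (2 + B / A * (exp (A * \<tau>) * h + h + 1)) * (1 + (x1 - x0)) \<le> \<kappa> * \<eta>"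
  shows "w + \<tau> + h < x1 \<and> (\<forall>s\<in>{x0 + \<tau>..w + \<tau>}. \<kappa> * \<eta> \<le> y s)"
proof -
  \<comment> \<open>With this shift \<open>A * k = B * \<epsilon>\<close> compensates the possibly
    negative \<open>B * y s \<ge> - B * \<epsilon>\<close>, so \<open>G'\<close> is bounded below by
    the delayed term alone.\<close>
  define k where "k = B * \<epsilon> / A"
  define G where "G = (\<lambda>s. exp (- (A * s)) * (y' s - k))"
  define G' where "G' = (\<lambda>s. exp (- (A * s)) * (B * y s + C s * y (s - \<tau>) + A * k))"
  have k: "k \<ge> 0" "A * k = B * \<epsilon>" using A B \<epsilon> by (auto simp: k_def)
  have DG: "(G has_real_derivative G' s) (at s)" for s unfolding G_def G'_def by (rule weighted_deriv)
  have D: "x1 - x0 \<ge> 0" using q w h by linarith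
  have ylow: "- \<epsilon> \<le> y s" if "x0 \<le> s" for s using low[OF that] late[of s] by linarith
  have bb: "B * y s + A * k \<ge> 0" if "x0 \<le> s" for s
  proof -
    have "B * (y s + \<epsilon>) \<ge> 0" using ylow[OF that] B by simp
    then show ?thesis using k by (simp add: algebra_simps)
  qed
  have G'0: "0 \<le> G' s" if "p + \<tau> \<le> s" "x0 \<le> s" "s \<le> q + \<tau>" for s
  proof -
    have "C s * y (s - \<tau>) \<ge> 0" using nn[of "s - \<tau>"] C(1)[of s] c T that \<tau> by simp
    then show ?thesis using bb[of s] that \<tau> by (simp add: G'_def)
  qed
  have G'1: "c * \<eta> * exp (- (A * (w + \<tau> + 2 * h))) \<le> G' s" "c * \<eta> * exp (- (A * s)) \<le> G' s"
    if "w + \<tau> \<le> s" "s \<le> w + \<tau> + 2 * h" for s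
  proof -
    have "c * \<eta> \<le> C s * y (s - \<tau>)"
      using win[of "s - \<tau>"] C(1)[of s] c T that \<tau> w \<eta> by (intro mult_mono) auto
    then have "c * \<eta> \<le> B * y s + C s * y (s - \<tau>) + A * k" using bb[of s] that \<tau> w by simp
    then show 1: "c * \<eta> * exp (- (A * s)) \<le> G' s" by (simp add: G'_def mult.commute)
    have "exp (- (A * (w + \<tau> + 2 * h))) \<le> exp (- (A * s))" using that A by simp
    then have "c * \<eta> * exp (- (A * (w + \<tau> + 2 * h))) \<le> c * \<eta> * exp (- (A * s))"
      using c \<eta> by (intro mult_left_mono) auto
    then show "c * \<eta> * exp (- (A * (w + \<tau> + 2 * h))) \<le> G' s" using 1 by linarith
  qed
  \<comment> \<open>Lower bound for the rate of change of the slope over a time \<open>h\<close>. It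
    yields a quadratic gain \<open>\<alpha> * h^2 / 2\<close>, at least twice the wanted
    \<open>\<kappa> * \<eta>\<close>; the second half pays for the errors of order
    \<open>\<epsilon>\<close>.\<close>
  define \<alpha> where "\<alpha> = c * \<eta> * exp (- (A * h))"
  have \<alpha>: "\<alpha> > 0" "2 * (\<kappa> * \<eta>) \<le> \<alpha> * h^2 / 2"
    using c \<eta> mult_right_mono[OF \<kappa>(2), of \<eta>] by (auto simp: \<alpha>_def field_simps)
  have \<kappa>\<eta>: "\<kappa> * \<eta> > 0" using \<kappa> \<eta> by simp
  have ba: "B / A > 0" using A B by simp
  have "w + \<tau> + h < x1"
  proof (rule ccontr)
    assume "\<not> w + \<tau> + h < x1"
    define a where "a = w + \<tau> + h"
    have a: "x1 \<le> a" "a + h - x1 \<le> \<tau>" "a + h \<le> q + \<tau>" "x0 + \<tau> \<le> a"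
      using \<open>\<not> w + \<tau> + h < x1\<close> w q h by (auto simp: a_def)
    \<comment> \<open>\<open>G\<close> does not decrease from \<open>x1\<close> to \<open>a\<close>
      and grows at a definite rate after \<open>a\<close>. Its initial value \<open>G x1\<close>
      comes from \<open>y' x1 = 0\<close> and is amplified by at most
      \<open>exp (A * \<tau>)\<close>. The factor \<open>exp (- (A * 0))\<close> below is 1.\<close>
    have slope: "\<alpha> * (s - a) - k * exp (A * \<tau>) \<le> y' s" if s: "a \<le> s" "s \<le> a + h" for s
    proof -
      have "0 * (a - x1) \<le> G a - G x1"
        by (rule deriv_lower_bound[OF a(1) DG]) (use G'0 p q w a h in auto)
      moreover have "c * \<eta> * exp (- (A * s)) * exp (- (A * 0)) * (s - a) \<le> G s - G a"
      proof (rule deriv_lower_bound[OF s(1) DG])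
        fix r assume r: "a \<le> r" "r \<le> s"
        have "exp (- (A * s)) \<le> exp (- (A * r))" using r A by simp
        then have "c * \<eta> * exp (- (A * s)) \<le> c * \<eta> * exp (- (A * r))"
          using c \<eta> by (intro mult_left_mono) auto
        then show "c * \<eta> * exp (- (A * s)) * exp (- (A * 0)) \<le> G' r"
          using G'1(2)[of r] r s h by (simp add: a_def)
      qed
      ultimately have "c * \<eta> * exp (- (A * s)) * (s - a) + G x1 \<le> G s" by simp
      then have "exp (A * s) * (c * \<eta> * exp (- (A * s)) * (s - a) + G x1) \<le> exp (A * s) * G s"
        by (intro mult_left_mono) auto
      moreover have "exp (A * s) * G s = y' s - k" "exp (A * s) * G x1 = - k * exp (A * (s - x1))"
        by (simp_all add: G_def x1 algebra_simps flip: exp_add mult.assoc)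
      moreover have "exp (A * s) * (c * \<eta> * exp (- (A * s)) * (s - a)) = c * \<eta> * (s - a)"
        by (simp add: exp_minus)
      ultimately have 1: "c * \<eta> * (s - a) - k * exp (A * (s - x1)) \<le> y' s - k"
        by (simp add: algebra_simps)
      have "k * exp (A * (s - x1)) \<le> k * exp (A * \<tau>)"
        using k A a s by (intro mult_left_mono) auto
      moreover have "\<alpha> * (s - a) \<le> c * \<eta> * (s - a)"
        using s c \<eta> A h by (intro mult_right_mono) (auto simp: \<alpha>_def)
      ultimately show ?thesis using 1 k by linarith
    qed
    have "0 * (a + h - a) \<le> (y (a + h) - \<alpha> * (a + h - a)^2 / 2 + k * exp (A * \<tau>) * (a + h))
        - (y a - \<alpha> * (a - a)^2 / 2 + k * exp (A * \<tau>) * a)"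
    proof (rule deriv_lower_bound)
      show "a \<le> a + h" using h by simp
      show "((\<lambda>s. y s - \<alpha> * (s - a)^2 / 2 + k * exp (A * \<tau>) * s) has_real_derivative
          y' s - \<alpha> * (s - a) + k * exp (A * \<tau>)) (at s)" for s
        by (auto intro!: derivative_eq_intros Dy)
      show "0 \<le> y' s - \<alpha> * (s - a) + k * exp (A * \<tau>)" if "a \<le> s" "s \<le> a + h" for s
        using slope[OF that] by linarith
    qed
    then have "\<alpha> * h^2 / 2 \<le> y (a + h) - y a + k * exp (A * \<tau>) * h" by (simp add: algebra_simps)
    \<comment> \<open>The growth over \<open>{a..a + h}\<close> contradicts \<open>late\<close>,
      since both ends lie beyond \<open>x1\<close>.\<close>
    moreover have "y (a + h) \<le> \<epsilon>" "- \<epsilon> \<le> y a" using late[of "a + h"] late[of a] a h by auto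
    ultimately have "2 * (\<kappa> * \<eta>) \<le> 2 * \<epsilon> + k * exp (A * \<tau>) * h" using \<alpha> by linarith
    also have "\<dots> = \<epsilon> * (2 + B / A * (exp (A * \<tau>) * h))" by (simp add: k_def algebra_simps)
    also have "\<dots> \<le> \<epsilon> * (2 + B / A * (exp (A * \<tau>) * h + h + 1))"
      using \<epsilon> ba h by (intro mult_left_mono add_left_mono) auto
    also have "\<dots> \<le> \<epsilon> * (2 + B / A * (exp (A * \<tau>) * h + h + 1)) * (1 + (x1 - x0))"
    proof -
      have "0 \<le> \<epsilon> * (2 + B / A * (exp (A * \<tau>) * h + h + 1))"
        using \<epsilon> ba h by (intro mult_nonneg_nonneg add_nonneg_nonneg) auto
      from mult_left_mono[of 1 "1 + (x1 - x0)", OF _ this] show ?thesis using D by simp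
    qed
    also have "\<dots> \<le> \<kappa> * \<eta>" by (rule small)
    finally show False using \<kappa>\<eta> by linarith
  qed
  moreover have "\<kappa> * \<eta> \<le> y s" if s: "x0 + \<tau> \<le> s" "s \<le> w + \<tau>" for s
  proof -
    define e where "e = w + \<tau> + h"
    have e: "e < x1" "e \<le> q + \<tau>" using \<open>w + \<tau> + h < x1\<close> w h by (auto simp: e_def)
    \<comment> \<open>Now \<open>e\<close> precedes \<open>x1\<close>, and
      \<open>x1 \<le> q + \<tau>\<close> keeps \<open>G\<close> nondecreasing up to
      \<open>x1\<close>, where it is at most 0. So slopes are bounded above going backwards, and
      \<open>y\<close> rises backwards from \<open>e\<close> to \<open>w + \<tau>\<close>.\<close>
    have Ge: "G e \<le> 0"
    proof -
      have "0 * (x1 - e) \<le> G x1 - G e"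
        by (rule deriv_lower_bound[OF _ DG]) (use G'0 p q w e h \<tau> in \<open>auto simp: e_def\<close>)
      moreover have "G x1 \<le> 0" using k by (simp add: G_def x1 zero_le_mult_iff)
      ultimately show ?thesis by simp
    qed
    have slope: "y' r \<le> k - \<alpha> * (e - r)" if r: "w + \<tau> \<le> r" "r \<le> e" for r
    proof -
      have "c * \<eta> * exp (- (A * e)) * (e - r) \<le> G e - G r"
      proof (rule deriv_lower_bound[OF r(2) DG])
        fix u assume u: "r \<le> u" "u \<le> e"
        have "exp (- (A * e)) \<le> exp (- (A * u))" using u A by simp
        then have "c * \<eta> * exp (- (A * e)) \<le> c * \<eta> * exp (- (A * u))"
          using c \<eta> by (intro mult_left_mono) auto
        then show "c * \<eta> * exp (- (A * e)) \<le> G' u"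
          using G'1(2)[of u] u r h by (simp add: e_def)
      qed
      then have "c * \<eta> * exp (- (A * e)) * (e - r) \<le> - G r" using Ge by linarith
      then have "exp (A * r) * (c * \<eta> * exp (- (A * e)) * (e - r)) \<le> exp (A * r) * - G r"
        by (intro mult_left_mono) auto
      moreover have "exp (A * r) * - G r = k - y' r"
        by (simp add: G_def algebra_simps flip: exp_add mult.assoc)
      moreover have "exp (A * r) * (c * \<eta> * exp (- (A * e)) * (e - r)) = c * \<eta> * exp (- (A * (e - r))) * (e - r)"
        by (simp add: exp_minus right_diff_distrib exp_diff divide_simps)
      moreover have "\<alpha> * (e - r) \<le> c * \<eta> * exp (- (A * (e - r))) * (e - r)"
        unfolding \<alpha>_def using r c \<eta> A by (intro mult_right_mono mult_left_mono) (auto simp: e_def)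
      ultimately show ?thesis by linarith
    qed
    have "0 * (e - (w + \<tau>)) \<le> (k * e + \<alpha> * (e - e)^2 / 2 - y e)
        - (k * (w + \<tau>) + \<alpha> * (e - (w + \<tau>))^2 / 2 - y (w + \<tau>))"
    proof (rule deriv_lower_bound)
      show "w + \<tau> \<le> e" using h by (simp add: e_def)
      show "((\<lambda>r. k * r + \<alpha> * (e - r)^2 / 2 - y r) has_real_derivative
          k - \<alpha> * (e - r) - y' r) (at r)" for r
        by (auto intro!: derivative_eq_intros Dy simp: field_simps)
      show "0 \<le> k - \<alpha> * (e - r) - y' r" if "w + \<tau> \<le> r" "r \<le> e" for r
        using slope[OF that] by linarith
    qed
    then have "\<alpha> * h^2 / 2 \<le> k * h + y (w + \<tau>) - y e" by (simp add: e_def algebra_simps)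
    moreover have "- \<epsilon> \<le> y e" using ylow[of e] w h \<tau> by (simp add: e_def)
    ultimately have 1: "2 * (\<kappa> * \<eta>) - \<epsilon> - k * h \<le> y (w + \<tau>)" using \<alpha> by linarith
    \<comment> \<open>Further back, down to \<open>x0 + \<tau>\<close>, only
      \<open>y' r \<le> k\<close> is available; this costs at most
      \<open>k * (x1 - x0)\<close>.\<close>
    have "- k * (w + \<tau> - s) \<le> - y (w + \<tau>) - (- y s)"
    proof (rule deriv_lower_bound[OF s(2) DERIV_minus[OF Dy]])
      fix r assume r: "s \<le> r" "r \<le> w + \<tau>"
      have "0 * (x1 - r) \<le> G x1 - G r"
        by (rule deriv_lower_bound[OF _ DG]) (use G'0 p q w e h \<tau> r s in \<open>auto simp: e_def\<close>)
      moreover have "G x1 \<le> 0" using k by (simp add: G_def x1 zero_le_mult_iff)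
      ultimately have "G r \<le> 0" by simp
      then show "- k \<le> - y' r" by (simp add: G_def mult_le_0_iff)
    qed
    moreover have "k * (w + \<tau> - s) \<le> k * (x1 - x0)"
      using k e s h \<tau> by (intro mult_left_mono) (auto simp: e_def)
    ultimately have 2: "2 * (\<kappa> * \<eta>) - (\<epsilon> + k * h + k * (x1 - x0)) \<le> y s" using 1 by simp
    have "\<epsilon> + k * h + k * (x1 - x0) = \<epsilon> * (1 + B / A * (h + (x1 - x0)))"
      using A by (simp add: k_def field_simps)
    also have "\<dots> \<le> \<epsilon> * ((2 + B / A * (exp (A * \<tau>) * h + h + 1)) * (1 + (x1 - x0)))"
    proof (intro mult_left_mono \<epsilon>)
      define E b where "E = exp (A * \<tau>) * h" and "b = B / A"
      have "E \<ge> 0" "b > 0" using h ba by (auto simp: E_def b_def)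
      then have "0 \<le> 1 + 2 * (x1 - x0) + b * (E + 1 + E * (x1 - x0) + h * (x1 - x0))"
        using h D by (intro add_nonneg_nonneg mult_nonneg_nonneg) auto
      then show "1 + B / A * (h + (x1 - x0)) \<le> (2 + B / A * (exp (A * \<tau>) * h + h + 1)) * (1 + (x1 - x0))"
        unfolding E_def[symmetric] b_def[symmetric] by (simp add: algebra_simps)
    qed
    also have "\<dots> \<le> \<kappa> * \<eta>" using small by (simp add: mult.assoc)
    finally show ?thesis using 2 by linarith
  qed
  ultimately show ?thesis by auto
qed

text \<open>A nonzero value at \<open>t\<close> lies under some hump whose extremum is at or after
  \<open>x1\<close>, so bounding the extrema suffices.\<close>

lemma later_bound:
  assumes h1: "hump (\<lambda>s. - y s) p1 x1 r" and t: "x1 \<le> t"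
    and b: "\<And>x p q. x1 \<le> x \<Longrightarrow> hump y p x q \<or> hump (\<lambda>s. - y s) p x q \<Longrightarrow> \<bar>y x\<bar> \<le> \<epsilon>"
  shows "\<bar>y t\<bar> \<le> \<epsilon>"
proof -
  interpret m: delay_eq \<tau> A B c c' T C "\<lambda>t. - y t" "\<lambda>t. - y' t" "\<lambda>t. - y'' t" by (rule minus)
  have b1: "\<bar>y x1\<bar> \<le> \<epsilon>" using b[of x1] h1 by blast
  have h: "p1 < x1" "x1 < r" "y x1 < 0" "\<And>s. p1 \<le> s \<Longrightarrow> s \<le> r \<Longrightarrow> 0 \<le> - y s \<and> - y s \<le> - y x1"
    "\<And>e. e > 0 \<Longrightarrow> \<exists>s. r < s \<and> s < r + e \<and> y s > 0" using h1 by (auto simp: hump_def)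
  consider "t \<le> r" | "y t = 0" | "y t > 0" | "t > r" "y t < 0" by linarith
  then show ?thesis
  proof cases
    case 1
    then show ?thesis using h(4)[of t] h(1) t b1 by linarith
  next
    case 2
    then show ?thesis using b1 by simp
  next
    case 3
    then have "x1 < t" using t h by (cases "x1 = t") auto
    then obtain p x q where x: "hump y p x q" "x1 \<le> p" "p < t" "t < q"
      using hump_after[of x1 t] h 3 by blast
    then have "x1 \<le> x" "\<bar>y t\<bar> \<le> \<bar>y x\<bar>" by (auto simp: hump_def)
    then show ?thesis using b[of x p q] x by linarith
  next
    case 4
    obtain z where z: "r < z" "z < t" "y z > 0" using h(5)[of "t - r"] 4 by auto
    then obtain p x q where x: "hump (\<lambda>s. - y s) p x q" "z \<le> p" "p < t" "t < q"
      using m.hump_after[of z t] 4 by auto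
    then have "x1 \<le> x" "\<bar>y t\<bar> \<le> \<bar>y x\<bar>" using h z by (auto simp: hump_def)
    then show ?thesis using b[of x p q] x by linarith
  qed
qed

end

section \<open>Excluding fast decay by iteration\<close>

lemma decay_rate_exists:
  fixes \<delta> \<tau> \<kappa> K :: real
  assumes "\<delta> > 0" "\<tau> > 0" "0 < \<kappa>" "\<kappa> < 1" "K > 0"
  obtains k0 where "k0 > 0"
    "\<And>k D n. k0 \<le> k \<Longrightarrow> \<delta> \<le> D \<Longrightarrow> real n \<le> 2 * D / \<tau> + 4 \<Longrightarrow>
      2 * exp (- (k * D)) * K * (1 + D) \<le> \<kappa> ^ n / 2"
proof
  define l where "l = - ln \<kappa>"
  define L where "L = \<bar>ln (4 * K)\<bar> + 4 * l"
  have l: "l > 0" using assms by (simp add: l_def)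
  then have L: "L > 0" by (simp add: L_def)
  \<comment> \<open>After taking logarithms, the summand 1 absorbs \<open>1 + D \<le> exp D\<close>,
    the second absorbs the part \<open>2 * D / \<tau>\<close> of \<open>n\<close>, and the third
    absorbs the constants because \<open>\<delta> \<le> D\<close>.\<close>
  show k0: "1 + 2 * l / \<tau> + L / \<delta> > 0" using l L assms by (simp add: add_pos_pos)
  fix k D :: real and n :: nat
  assume k: "1 + 2 * l / \<tau> + L / \<delta> \<le> k" and D: "\<delta> \<le> D" and n: "real n \<le> 2 * D / \<tau> + 4"
  have "(1 + 2 * l / \<tau> + L / \<delta>) * D \<le> k * D" using k D assms by (intro mult_right_mono) auto
  moreover have "L \<le> L / \<delta> * D" using L D assms by (simp add: field_simps)
  moreover have "l * real n \<le> l * (2 * D / \<tau> + 4)" using n l by (intro mult_left_mono) auto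
  ultimately have main: "ln (4 * K) + D - k * D \<le> - l * real n"
    by (simp add: L_def algebra_simps)
  have "4 * (exp (- (k * D)) * K * (1 + D)) \<le> 4 * (exp (- (k * D)) * K * exp D)"
    using assms exp_ge_add_one_self[of D] by (intro mult_left_mono) auto
  also have "\<dots> = exp (ln (4 * K)) * exp D * exp (- (k * D))" using assms by simp
  also have "\<dots> = exp (ln (4 * K) + D - k * D)" by (simp add: exp_add exp_diff exp_minus field_simps)
  also have "\<dots> \<le> exp (- l * real n)" using main by simp
  also have "\<dots> = \<kappa> ^ n" using assms by (simp add: l_def mult.commute exp_of_nat_mult)
  finally show "2 * exp (- (k * D)) * K * (1 + D) \<le> \<kappa> ^ n / 2" by simp
qed

context delay_eq
begin

text \<open>The rate \<open>k0\<close> is fixed before the hump: the number of propagation steps is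
  at most linear in \<open>x1 - x0\<close>, so the accumulated loss is a power of
  \<open>\<kappa>\<close> that a large rate beats uniformly.\<close>

lemma no_fast_decay:
  "\<exists>k0>0. \<forall>k\<ge>k0. \<forall>p x0 q. T \<le> x0 \<longrightarrow> hump y p x0 q \<longrightarrow>
     \<not> (\<forall>x p' q'. x0 \<le> x \<longrightarrow> hump y p' x q' \<or> hump (\<lambda>s. - y s) p' x q' \<longrightarrow>
         \<bar>y x\<bar> \<le> 2 * exp (- (k * (x - x0))) * y x0)"
proof -
  interpret m: delay_eq \<tau> A B c c' T C "\<lambda>t. - y t" "\<lambda>t. - y' t" "\<lambda>t. - y'' t" by (rule minus)
  \<comment> \<open>\<open>K\<close> times the height bounds the downward slope.
    \<open>4 * h \<le> 1 / (2 * K)\<close> keeps \<open>y\<close> above half its height for a time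
    \<open>4 * h\<close>, and \<open>4 * h \<le> \<tau>\<close> makes each iteration advance by at
    least \<open>\<tau> / 2\<close>.\<close>
  define K where "K = (B + c') / A"
  define h where "h = min (1 / (8 * K)) (\<tau> / 4)"
  define \<kappa> where "\<kappa> = min (c * exp (- (A * h)) * h^2 / 4) (1 / 2)"
  define K4 where "K4 = 2 + B / A * (exp (A * \<tau>) * h + h + 1)"
  have K: "K > 0" using A B c' by (simp add: K_def)
  have h: "h > 0" "4 * h \<le> \<tau>" "4 * h \<le> 1 / (2 * K)" using K \<tau> by (auto simp: h_def min_def field_simps)
  have \<kappa>: "0 < \<kappa>" "\<kappa> < 1" "\<kappa> \<le> c * exp (- (A * h)) * h^2 / 4" using c h by (auto simp: \<kappa>_def)
  have K4: "K4 > 0" using A B h by (auto simp: K4_def intro!: add_pos_nonneg)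
  obtain k0 where k0: "k0 > 0" and rate: "\<And>k D n. k0 \<le> k \<Longrightarrow> 1 / K \<le> D \<Longrightarrow> real n \<le> 2 * D / \<tau> + 4 \<Longrightarrow>
      2 * exp (- (k * D)) * K4 * (1 + D) \<le> \<kappa> ^ n / 2"
    using decay_rate_exists[of "1 / K" \<tau> \<kappa> K4] K \<tau> \<kappa> K4 by (metis zero_less_divide_1_iff)
  show ?thesis
  proof (intro exI[of _ k0] conjI allI impI notI k0)
    fix k p x0 q
    assume k: "k0 \<le> k" and x0: "T \<le> x0" and hump0: "hump y p x0 q"
      and decay: "\<forall>x p' q'. x0 \<le> x \<longrightarrow> hump y p' x q' \<or> hump (\<lambda>s. - y s) p' x q' \<longrightarrow>
         \<bar>y x\<bar> \<le> 2 * exp (- (k * (x - x0))) * y x0"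
    define m where "m = y x0"
    have h0: "p < x0" "x0 < q" "m > 0" "\<And>s. p \<le> s \<Longrightarrow> s \<le> q \<Longrightarrow> 0 \<le> y s \<and> y s \<le> m"
      "\<And>e. e > 0 \<Longrightarrow> \<exists>s. p - e < s \<and> s < p \<and> y s < 0"
      using hump0 by (auto simp: hump_def m_def)
    obtain p1 x1 r where hump1: "hump (\<lambda>s. - y s) p1 x1 r" and p1: "x0 \<le> p1" "p1 \<le> q" "q < x1"
      using next_hump[OF hump0 x0] by blast
    have h1: "p1 < x1" "x1 < r" "y x1 < 0" "\<And>s. p1 \<le> s \<Longrightarrow> s \<le> r \<Longrightarrow> y s \<le> 0 \<and> y x1 \<le> y s"
      using hump1 by (auto simp: hump_def)
    have "T \<le> x1" using x0 p1 h0 by linarith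
    note d0 = hump_delay[OF hump0 x0] and d1 = m.hump_delay[OF hump1 this]
    have x1': "y' x1 = 0" using m.hump_extremum(1)[OF hump1] by simp
    \<comment> \<open>\<open>hump_delay\<close> for the next hump gives nonnegativity on
      \<open>{x1 - \<tau>..p1}\<close>; the rest lies in the present hump.\<close>
    have nn: "0 \<le> y s" if "x1 - \<tau> \<le> s \<or> p \<le> s" "s \<le> q" for s
      using d1(3)[of s] h0(4)[of s] that h0(1) p1 by (cases "s \<le> p1") auto
    have px1: "p \<le> x1 - \<tau>"
    proof (rule ccontr)
      assume "\<not> p \<le> x1 - \<tau>"
      then obtain z where "x1 - \<tau> < z" "z < p" "y z < 0" using h0(5)[of "p - (x1 - \<tau>)"] by auto
      then show False using nn[of z] h0 by auto
    qed
    have slope: "- (K * m) \<le> y' a" if a: "x0 \<le> a" "a \<le> x1" for a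
    proof (rule slope_ge[OF a(2) x1'])
      fix s assume s: "a \<le> s" "s \<le> x1"
      have "y s \<le> m"
        using h0(1,3) h0(4)[of s] h1(2) h1(4)[of s] p1 s a by (cases "s \<le> q") linarith+
      then have "B * y s \<le> B * m" using B by simp
      moreover have "C s * y (s - \<tau>) \<le> c' * m"
      proof (cases "s - \<tau> \<le> p")
        case True
        then have "C s * y (s - \<tau>) \<le> 0" using d0(3)[of "s - \<tau>"] C(1)[of s] c x0 s a
          by (intro mult_nonneg_nonpos) auto
        also have "0 \<le> c' * m" using c' h0 by simp
        finally show ?thesis .
      next
        case False
        then show ?thesis using h0(4)[of "s - \<tau>"] C(2)[of s] c' x0 s a d1(1) p1
          by (intro mult_mono) auto
      qed
      moreover have "A * (K * m) = B * m + c' * m" using A by (simp add: K_def field_simps)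
      ultimately show "B * y s + C s * y (s - \<tau>) \<le> A * (K * m)" by linarith
    qed (use K h0 in simp)
    have lip: "m - K * m * (s - x0) \<le> y s" if s: "x0 \<le> s" "s \<le> x1" for s
    proof -
      have "- (K * m) * (s - x0) \<le> y s - y x0"
        by (rule deriv_lower_bound[OF s(1) Dy]) (use slope s in auto)
      then show ?thesis by (simp add: m_def)
    qed
    define D where "D = x1 - x0"
    \<comment> \<open>A slope of at least \<open>- (K * m)\<close> needs a time longer than
      \<open>1 / K\<close> to bring \<open>y\<close> from \<open>m\<close> below 0.\<close>
    have "m < m * (K * D)" using lip[of x1] h1(3) p1 h0 by (simp add: D_def algebra_simps)
    then have D: "1 / K \<le> D" using h0(3) K by (simp add: field_simps)
    moreover have "1 / (2 * K) \<le> 1 / K" using K by (simp add: field_simps)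
    ultimately have hD: "x0 + 4 * h \<le> x1" using h unfolding D_def by linarith
    define \<epsilon> where "\<epsilon> = 2 * exp (- (k * D)) * m"
    have \<epsilon>: "\<epsilon> \<ge> 0" using h0 by (simp add: \<epsilon>_def)
    have late: "\<bar>y t\<bar> \<le> \<epsilon>" if "t \<ge> x1" for t
    proof (rule later_bound[OF hump1 that])
      fix x p' q' assume x: "x1 \<le> x" "hump y p' x q' \<or> hump (\<lambda>s. - y s) p' x q'"
      then have "\<bar>y x\<bar> \<le> 2 * exp (- (k * (x - x0))) * m"
        using decay[rule_format, of x p' q'] p1 h0(2) by (simp add: m_def)
      also have "k * D \<le> k * (x - x0)" using k k0 x by (auto simp: D_def)
      then have "2 * exp (- (k * (x - x0))) * m \<le> \<epsilon>" using h0 by (simp add: \<epsilon>_def)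
      finally show "\<bar>y x\<bar> \<le> \<epsilon>" .
    qed
    have low: "- \<epsilon> \<le> y s" if "x0 \<le> s" "s \<le> x1" for s
    proof (cases "s \<le> q")
      case True
      then show ?thesis using nn[OF disjI2, of s] \<epsilon> h0(1) that by linarith
    next
      case False
      then show ?thesis using h1(2) h1(4)[of s] late[of x1] p1 that by linarith
    qed
    have step: "w + \<tau> + h < x1 \<and> (\<forall>s\<in>{x0 + \<tau>..w + \<tau>}. \<kappa> * \<eta> \<le> y s)"
      if w: "x0 \<le> w" "w + 2 * h \<le> x1" and \<eta>: "\<eta> = \<kappa> ^ n * (m / 2)" and n: "real n \<le> 2 * D / \<tau> + 3"
        and win: "\<And>s. w \<le> s \<Longrightarrow> s \<le> w + 2 * h \<Longrightarrow> \<eta> \<le> y s" for w \<eta> n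
    proof -
      have \<eta>0: "\<eta> > 0" unfolding \<eta> using \<kappa>(1) h0(3) by simp
      \<comment> \<open>Between \<open>q\<close> and \<open>x1\<close> the function is nonpositive,
        so a positive window must end by \<open>q\<close>.\<close>
      have wq: "w + 2 * h \<le> q"
      proof (rule ccontr)
        assume "\<not> w + 2 * h \<le> q"
        then have "y (w + 2 * h) \<le> 0" using h1(4)[of "w + 2 * h"] w p1 h1 by auto
        then show False using win[of "w + 2 * h"] h \<eta>0 by auto
      qed
      have "2 * exp (- (k * D)) * K4 * (1 + D) \<le> \<kappa> ^ Suc n / 2" using rate[OF k D, of "Suc n"] n by simp
      from mult_right_mono[OF this, of m] have "\<epsilon> * K4 * (1 + D) \<le> \<kappa> * \<eta>"
        using h0 by (simp add: \<epsilon>_def \<eta> algebra_simps)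
      then show ?thesis
        by (intro propagate[where q = q and p = p, OF x0 w(1) wq h(1) \<eta>0 \<epsilon> p1(3)])
           (use px1 h0(1) d1(1) p1 nn low late x1' win \<kappa> in \<open>auto simp: K4_def D_def\<close>)
    qed
    \<comment> \<open>Start of the last window of length \<open>2 * h\<close> in the interval
      reached so far; a step extends the right end from \<open>w n + 2 * h\<close> to
      \<open>w n + \<tau>\<close>. The base case already uses one step, from
      \<open>x0 + 2 * h\<close>, hence the exponent \<open>Suc n\<close>.\<close>
    define w where "w = (\<lambda>n::nat. x0 + \<tau> + real n * (\<tau> - 2 * h))"
    have iter: "w n + 2 * h \<le> x1 \<and> (\<forall>s\<in>{x0 + \<tau>..w n + 2 * h}. \<kappa> ^ Suc n * (m / 2) \<le> y s)"
      if "real n \<le> 2 * D / \<tau> + 2" for n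
      using that
    proof (induction n)
      case 0
      have "m / 2 \<le> y s" if s: "x0 \<le> s" "s \<le> x0 + 4 * h" for s
      proof -
        have "K * (s - x0) \<le> 1 / 2" using s h K mult_left_mono[of "s - x0" "1 / (2 * K)" K] by simp
        then have "m * (K * (s - x0)) \<le> m * (1 / 2)" using h0 by (intro mult_left_mono) auto
        then show ?thesis using lip[of s] s hD by (simp add: algebra_simps)
      qed
      then have "x0 + 2 * h + \<tau> + h < x1 \<and> (\<forall>s\<in>{x0 + \<tau>..x0 + 2 * h + \<tau>}. \<kappa> * (m / 2) \<le> y s)"
        using h hD 0 by (intro step[where n = 0]) auto
      then show ?case using h by (auto simp: w_def add_ac)
    next
      case (Suc n)
      then have IH: "w n + 2 * h \<le> x1" "\<And>s. x0 + \<tau> \<le> s \<Longrightarrow> s \<le> w n + 2 * h \<Longrightarrow> \<kappa> ^ Suc n * (m / 2) \<le> y s"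
        by auto
      have wn: "x0 + \<tau> \<le> w n" using h by (simp add: w_def)
      have "w n + \<tau> + h < x1 \<and> (\<forall>s\<in>{x0 + \<tau>..w n + \<tau>}. \<kappa> * (\<kappa> ^ Suc n * (m / 2)) \<le> y s)"
        using IH wn \<tau> Suc.prems by (intro step[OF _ _ refl]) auto
      moreover have "w (Suc n) + 2 * h = w n + \<tau>" by (simp add: w_def algebra_simps)
      ultimately show ?case using h by (auto simp: mult.assoc)
    qed
    \<comment> \<open>So many advances of at least \<open>\<tau> / 2\<close> cover \<open>D\<close>
      and carry the window past \<open>x1\<close>.\<close>
    define n where "n = nat \<lceil>2 * D / \<tau>\<rceil>"
    have "0 < D" using D K by (meson less_le_trans zero_less_divide_1_iff)
    then have n: "2 * D / \<tau> \<le> real n" "real n \<le> 2 * D / \<tau> + 2" using \<tau> by (auto simp: n_def; linarith)+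
    have "D = 2 * D / \<tau> * (\<tau> / 2)" using \<tau> by simp
    also have "\<dots> \<le> real n * (\<tau> - 2 * h)" using n h \<tau> \<open>0 < D\<close> by (intro mult_mono) auto
    finally have "x1 < w n + 2 * h" using \<tau> h by (simp add: w_def D_def)
    then show False using iter[OF n(2)] by simp
  qed
qed

end

section \<open>From slow oscillation to the contradiction\<close>

lemma sc_two_alternation:
  assumes "sc \<tau> v = 1 \<or> sc \<tau> v = 2"
    and K: "s1 \<in> KK \<tau>" "s2 \<in> KK \<tau>" "s3 \<in> KK \<tau>" "s4 \<in> KK \<tau>" and less: "s1 < s2" "s2 < s3" "s3 < s4"
    and alt: "v s1 * v s2 < 0" "v s2 * v s3 < 0" "v s3 * v s4 < 0"
  shows False
proof -
  define S where "S = {k. k \<ge> 1 \<and> (\<exists>t :: nat \<Rightarrow> real. (\<forall>j\<in>{0..k}. t j \<in> KK \<tau>) \<and>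
               (\<forall>i\<in>{1..k}. t (i - 1) < t i) \<and> (\<forall>i\<in>{1..k}. v (t (i - 1)) * v (t i) < 0))}"
  define t where "t = (\<lambda>j::nat. [s1, s2, s3, s4] ! j)"
  have "\<forall>j\<in>{0..3}. t j \<in> KK \<tau>" "\<forall>i\<in>{1..3}. t (i - 1) < t i" "\<forall>i\<in>{1..3}. v (t (i - 1)) * v (t i) < 0"
    using K less alt by (auto simp: t_def numeral_3_eq_3 atLeastAtMostSuc_conv atLeast0_atMost_Suc)
  \<comment> \<open>\<open>S\<close> counts sign changes, not points: four alternating points give
    3. Values of both signs exclude the case in which \<open>sc\<close> is 0 by definition.\<close>
  then have "3 \<in> S" unfolding S_def by auto
  then have "enat 3 \<le> Sup (enat ` S)" by (intro Sup_upper) auto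
  moreover have "sc \<tau> v = Sup (enat ` S)"
    using K alt unfolding sc_def S_def by (auto simp: mult_less_0_iff)
  ultimately show False using assms(1) by (auto simp: one_enat_def numeral_eq_enat)
qed

theorem lemma15:
  fixes \<tau> A B C_inf :: real and C y :: "real \<Rightarrow> real"
  assumes "\<tau> > 0" and "A > 0" and "B > 0"
    and "continuous_on UNIV C"
    and "C_inf > 0" and "(C \<longlongrightarrow> C_inf) at_top"
    and "delay_solution \<tau> A B C y"
    and "(y \<longlongrightarrow> 0) at_top"
    and "slowly_oscillates \<tau> y 0"
    and "\<not> (\<exists>a b. a < b \<and> {a..b} \<subseteq> {t. deriv y t = 0})"
  shows "\<not> super_exponentially_decaying y"
proof
  assume small: "super_exponentially_decaying y"
  obtain T0 T1 where osc: "oscillates_around y 0"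
    and sc: "\<And>t. t \<ge> T1 \<Longrightarrow> sc \<tau> (seg y 0 t) = 1 \<or> sc \<tau> (seg y 0 t) = 2"
    using assms(9) by (auto simp: slowly_oscillates_def slowly_oscillating_on_def)
  have "eventually (\<lambda>t. C t > C_inf / 2) at_top" "eventually (\<lambda>t. C t < 2 * C_inf) at_top"
    using order_tendstoD(1)[OF assms(6), of "C_inf / 2"] order_tendstoD(2)[OF assms(6), of "2 * C_inf"] assms(5)
    by simp_all
  then have "eventually (\<lambda>t. C_inf / 2 \<le> C t \<and> C t \<le> 2 * C_inf) at_top" by eventually_elim auto
  then obtain T2 where T2: "\<And>t. t \<ge> T2 \<Longrightarrow> C_inf / 2 \<le> C t \<and> C t \<le> 2 * C_inf"
    by (auto simp: eventually_at_top_linorder)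
  define T where "T = max T1 T2"
  interpret L: delay_eq \<tau> A B "C_inf / 2" "2 * C_inf" T C y "deriv y" "deriv (deriv y)"
  proof
    show "(y has_real_derivative deriv y t) (at t)" "(deriv y has_real_derivative deriv (deriv y) t) (at t)" for t
      using assms(7) by (auto simp: delay_solution_def DERIV_deriv_iff_real_differentiable)
    show "deriv (deriv y) t = A * deriv y t + (B * y t + C t * y (t - \<tau>))" for t
    proof -
      have "deriv (deriv y) t - A * deriv y t - B * y t - C t * y (t - \<tau>) = 0"
        using assms(7) by (simp add: delay_solution_def)
      then show ?thesis by simp
    qed
    show "\<exists>s\<ge>t. y s > 0" "\<exists>s\<ge>t. y s < 0" for t using osc by (auto simp: oscillates_around_def)
    show False if s: "T \<le> t" "t - \<tau> \<le> s1" "s1 < s2" "s2 < s3" "s3 < s4" "s4 \<le> t"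
        "y s1 * y s2 < 0" "y s2 * y s3 < 0" "y s3 * y s4 < 0" for t s1 s2 s3 s4
    proof -
      have "sc \<tau> (seg y 0 t) = 1 \<or> sc \<tau> (seg y 0 t) = 2" using sc s by (simp add: T_def)
      then show False
        by (rule sc_two_alternation[of \<tau> _ "s1 - t" "s2 - t" "s3 - t" "s4 - t"])
           (use s in \<open>auto simp: KK_def seg_def\<close>)
    qed
  qed (use assms T2 in \<open>auto simp: T_def\<close>)
  interpret M: delay_eq \<tau> A B "C_inf / 2" "2 * C_inf" T C "\<lambda>t. - y t" "\<lambda>t. - deriv y t" "\<lambda>t. - deriv (deriv y) t"
    by (rule L.minus)
  obtain k1 where k1: "k1 > 0" and fast1: "\<forall>k\<ge>k1. \<forall>p x0 q. T \<le> x0 \<longrightarrow> hump y p x0 q \<longrightarrow>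
     \<not> (\<forall>x p' q'. x0 \<le> x \<longrightarrow> hump y p' x q' \<or> hump (\<lambda>s. - y s) p' x q' \<longrightarrow>
         \<bar>y x\<bar> \<le> 2 * exp (- (k * (x - x0))) * y x0)"
    using L.no_fast_decay by blast
  obtain k2 where fast2: "\<forall>k\<ge>k2. \<forall>p x0 q. T \<le> x0 \<longrightarrow> hump (\<lambda>s. - y s) p x0 q \<longrightarrow>
     \<not> (\<forall>x p' q'. x0 \<le> x \<longrightarrow> hump (\<lambda>s. - y s) p' x q' \<or> hump y p' x q' \<longrightarrow>
         \<bar>y x\<bar> \<le> 2 * exp (- (k * (x - x0))) * - y x0)"
    using M.no_fast_decay unfolding minus_minus abs_minus_cancel by blast
  \<comment> \<open>One rate serves humps of both signs, as the sign of the selected hump is not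
    known in advance.\<close>
  define k where "k = max k1 k2"
  have k: "k > 0" "k1 \<le> k" "k2 \<le> k" using k1 by (auto simp: k_def)
  have "eventually (\<lambda>t. \<bar>exp (k * t) * y t\<bar> < 1) at_top"
    using small k(1) tendstoD[of "\<lambda>t. exp (k * t) * y t" 0 at_top 1]
    by (auto simp: super_exponentially_decaying_def)
  then obtain T3 where T3: "\<And>t. t \<ge> T3 \<Longrightarrow> \<bar>exp (k * t) * y t\<bar> < 1"
    by (auto simp: eventually_at_top_linorder)
  define S where "S = {x. max T T3 \<le> x \<and> (\<exists>p q. hump y p x q \<or> hump (\<lambda>s. - y s) p x q)}"
  \<comment> \<open>Weighted heights, bounded by smallness at the rate \<open>k\<close>. An extremum
    with more than half of their supremum exists even if the supremum is not attained; the half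
    becomes the factor 2 in \<open>decay\<close>.\<close>
  define g where "g = (\<lambda>x. exp (k * x) * \<bar>y x\<bar>)"
  have bdd: "bdd_above (g ` S)"
    using T3 by (intro bdd_aboveI[of _ 1]) (fastforce simp: S_def g_def abs_mult)
  obtain z where z: "z \<in> S"
  proof -
    obtain u where u: "u \<ge> max T T3" "y u < 0" using L.neg by blast
    obtain t where t: "t \<ge> u" "y t > 0" using L.pos by blast
    then have "u < t" using u by (cases "u = t") auto
    then obtain p x q where "hump y p x q" "u \<le> p" using L.hump_after u t by blast
    then have "x \<in> S" using u by (auto simp: S_def hump_def)
    then show ?thesis by (rule that)
  qed
  have upper: "g x \<le> Sup (g ` S)" if "x \<in> S" for x using bdd that by (intro cSup_upper) auto
  have "y z \<noteq> 0" using z by (auto simp: S_def hump_def)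
  then have "g z > 0" by (simp add: g_def)
  then have "Sup (g ` S) / 2 < Sup (g ` S)" using upper[OF z] by simp
  then obtain x0 where x0: "x0 \<in> S" "Sup (g ` S) / 2 < g x0"
    using less_cSupE[of "Sup (g ` S) / 2" "g ` S"] z by blast
  have decay: "\<bar>y x\<bar> \<le> 2 * exp (- (k * (x - x0))) * \<bar>y x0\<bar>"
    if "x0 \<le> x" "hump y p x q \<or> hump (\<lambda>s. - y s) p x q" for x p q
  proof -
    have "x \<in> S" using that x0 by (auto simp: S_def)
    then have "exp (k * x) * \<bar>y x\<bar> \<le> 2 * (exp (k * x0) * \<bar>y x0\<bar>)" using upper[of x] x0 by (simp add: g_def)
    also have "exp (k * x0) = exp (k * x) * exp (- (k * (x - x0)))"
      by (simp add: right_diff_distrib flip: exp_add)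
    finally show ?thesis by (simp add: mult.assoc mult.left_commute[of _ "exp (k * x)"])
  qed
  from x0(1) obtain p q where "T \<le> x0" "hump y p x0 q \<or> hump (\<lambda>s. - y s) p x0 q" by (auto simp: S_def)
  then show False
  proof (elim disjE)
    assume h: "hump y p x0 q"
    then have "\<bar>y x0\<bar> = y x0" by (simp add: hump_def)
    then show False using fast1 k(2) \<open>T \<le> x0\<close> h decay by metis
  next
    assume h: "hump (\<lambda>s. - y s) p x0 q"
    then have "\<bar>y x0\<bar> = - y x0" by (simp add: hump_def)
    then show False using fast2 k(3) \<open>T \<le> x0\<close> h decay by metis
  qed
qed

end
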